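(* Let $\mathcal{H}$ be a $k$-uniform hypergraph with $m$ edges and incidence matrix $\mathbf{B}$, and let $r=\mathrm{rank}(\mathbf{B})$. Then $\mathtt{BE}(\mathcal{H}) \le \sqrt{kmr} \le \sqrt{k}\,m$. Equality holds if and only if the edges of $\mathcal{H}$ are pairwise disjoint.
   Context: A hypergraph $\mathcal{H}=(V,E)$ has a finite vertex set $V$ and an edge set $E\subseteq 2^V$; it is $k$-uniform ($k\ge2$) if every edge has exactly $k$ vertices. Its incidence matrix $\mathbf{B}$ is the $|V|\times|E|$ matrix with $b(v,e)=1$ if $v\in e$ and $0$ otherwise. The incidence energy $\mathtt{BE}(\mathcal{H})$ is the sum of the singular values of $\mathbf{B}$ (i.e. of the square roots of the eigenvalues of $\mathbf{B}\mathbf{B}^T$) if $\mathcal{H}$ has at least one edge, and $0$ otherwise. *)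

theory Defs
  imports
    Complex_Main
    "HOL-Library.Multiset"
    "Jordan_Normal_Form.Char_Poly"
    "Jordan_Normal_Form.DL_Rank"
begin

definition hypergraph :: "'a set \<Rightarrow> 'a set set \<Rightarrow> bool" where
  "hypergraph V E \<longleftrightarrow> finite V \<and> E \<subseteq> Pow V"

definition uniform_hypergraph :: "nat \<Rightarrow> 'a set \<Rightarrow> 'a set set \<Rightarrow> bool" where
  "uniform_hypergraph k V E \<longleftrightarrow> hypergraph V E \<and> k \<ge> 2 \<and> (\<forall>e\<in>E. card e = k)"

(* Matrices are indexed by natural numbers, so the rows and columns of the incidence
   matrix follow listings (without repetition) of the vertices and of the edges. *)
definition lists_set :: "'b list \<Rightarrow> 'b set \<Rightarrow> bool" where
  "lists_set xs A \<longleftrightarrow> distinct xs \<and> set xs = A"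

definition incidence_matrix :: "'a list \<Rightarrow> 'a set list \<Rightarrow> real mat" where
  "incidence_matrix vs es =
     mat (length vs) (length es) (\<lambda>(i, j). if vs ! i \<in> es ! j then 1 else 0)"

(* Square roots of the eigenvalues of A A^T, repeated according to multiplicity. Since A A^T
   is real symmetric and positive semidefinite, its characteristic polynomial splits over the
   reals with nonnegative roots, so no eigenvalue is lost by taking real roots. *)
definition singular_values :: "real mat \<Rightarrow> real multiset" where
  "singular_values A = image_mset sqrt (proots (char_poly (A * transpose_mat A)))"

definition incidence_energy :: "'a list \<Rightarrow> 'a set list \<Rightarrow> real" where
  "incidence_energy vs es =
     (if es = [] then 0 else \<Sum>\<^sub># (singular_values (incidence_matrix vs es)))"

end

theory Submission
  imports
    Defs
    "Jordan_Normal_Form.Jordan_Normal_Form_Existence"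
    "Jordan_Normal_Form.Jordan_Normal_Form_Uniqueness"
begin

text \<open>
  The eigenvalues of $B B^T$ are nonnegative with sum $km$ (the trace), and exactly $r$ of them
  are nonzero, so the bound is the Cauchy-Schwarz inequality for the $r$ nonzero singular values.
  Equality forces all nonzero eigenvalues to coincide with some $c$, that is, $N = B B^T$
  satisfies $N^2 = cN$. As $N$ is entrywise nonnegative, a Perron-type argument shows that two
  columns of $N$ indexed by adjacent vertices $u$, $v$ are proportional, whence
  $N_{uv}^2 = N_{uu} N_{vv}$. Since $N_{uv}$ counts the edges through both $u$ and $v$, this
  means that $u$ and $v$ lie on the same edges, and therefore intersecting edges coincide.
  Conversely, for disjoint edges $B^T B = kI$, so every nonzero eigenvalue of $B B^T$ is $k$,
  and the trace gives $r = m$.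
\<close>

section \<open>Diagonalization of real symmetric matrices\<close>

text \<open>Pair an eigenvector \<open>v\<close> with its conjugate: moving the symmetric matrix
  across \<open>v \<bullet> conjugate v\<close> multiplies this product by \<open>a\<close> on one
  side and by \<open>cnj a\<close> on the other. The product is the squared norm of
  \<open>v\<close>, hence nonzero.\<close>

lemma symmetric_real_eigenvalue_Reals:
  fixes A :: "real mat" and a :: complex
  assumes A: "A \<in> carrier_mat n n" and sym: "transpose_mat A = A"
    and ev: "eigenvalue (map_mat complex_of_real A) a"
  shows "a \<in> \<real>"
proof -
  let ?C = "map_mat complex_of_real A"
  have C: "?C \<in> carrier_mat n n" using A by simp
  from ev obtain v where v: "v \<in> carrier_vec n" and v0: "v \<noteq> 0\<^sub>v n" and Cv: "?C *\<^sub>v v = a \<cdot>\<^sub>v v"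
    using A unfolding eigenvalue_def eigenvector_def by auto
  let ?w = "conjugate v"
  have w: "?w \<in> carrier_vec n" using v by simp
  have symC: "transpose_mat ?C = ?C" using sym by (metis map_mat_transpose)
  have Cw: "?C *\<^sub>v ?w = cnj a \<cdot>\<^sub>v ?w"
  proof -
    have "?C *\<^sub>v ?w = conjugate (?C *\<^sub>v v)"
      by (rule eq_vecI) (use A v in \<open>auto simp: scalar_prod_def\<close>)
    also have "\<dots> = cnj a \<cdot>\<^sub>v ?w"
      unfolding Cv by (rule eq_vecI) (use v in auto)
    finally show ?thesis .
  qed
  have "a * (v \<bullet> ?w) = (?C *\<^sub>v v) \<bullet> ?w" using v w Cv by simp
  also have "\<dots> = v \<bullet> (?C *\<^sub>v ?w)"
    using transpose_vec_mult_scalar[OF C w v] symC by simp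
  also have "\<dots> = cnj a * (v \<bullet> ?w)" unfolding Cw using v w by simp
  finally have "a = cnj a"
    using conjugate_square_eq_0_vec[OF v] v0 by simp
  then show ?thesis by (simp add: Reals_cnj_iff)
qed

text \<open>The complex factorization has only real roots and descends to the reals because the
  embedding of coefficients is injective. Splitting is what the existence of a real Jordan form
  requires.\<close>

lemma symmetric_char_poly_splits:
  fixes A :: "real mat"
  assumes A: "A \<in> carrier_mat n n" and sym: "transpose_mat A = A"
  shows "\<exists>as. char_poly A = (\<Prod>a\<leftarrow>as. [:- a, 1:])"
proof -
  let ?C = "map_mat complex_of_real A"
  have C: "?C \<in> carrier_mat n n" using A by simp
  obtain as where as: "char_poly ?C = (\<Prod>a\<leftarrow>as. [:- a, 1:])"
    using char_poly_factorized[OF C] by blast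
  have real: "a \<in> \<real>" if "a \<in> set as" for a
  proof (rule symmetric_real_eigenvalue_Reals[OF A sym])
    have "poly (char_poly ?C) a = 0"
      unfolding as poly_prod_list prod_list_zero_iff using that by force
    then show "eigenvalue ?C a" using eigenvalue_root_char_poly[OF C] by simp
  qed
  interpret h: map_poly_inj_comm_ring_hom complex_of_real ..
  have "map_poly complex_of_real (char_poly A) = char_poly ?C"
    by (rule of_real_hom.char_poly_hom[OF A, symmetric])
  also have "\<dots> = (\<Prod>a\<leftarrow>as. map_poly complex_of_real [:- Re a, 1:])"
    unfolding as by (rule arg_cong[where f = prod_list])
      (use real in \<open>auto simp: complex_is_Real_iff complex_eq_iff\<close>)
  also have "\<dots> = map_poly complex_of_real (\<Prod>a\<leftarrow>map Re as. [:- a, 1:])"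
    by (simp add: h.hom_prod_list o_def)
  finally have "char_poly A = (\<Prod>a\<leftarrow>map Re as. [:- a, 1:])" by (rule h.injectivity)
  then show ?thesis by blast
qed

lemma real_scalar_prod_self_eq_0D: "(v :: real vec) \<in> carrier_vec n \<Longrightarrow> v \<bullet> v = 0 \<Longrightarrow> v = 0\<^sub>v n"
  using conjugate_square_eq_0_vec[of v n] by (simp add: conjugate_vec_def vec_eq_iff)

lemma jordan_matrix_diagonal:
  assumes "\<And>n a. (n, a) \<in> set n_as \<Longrightarrow> n \<le> 1"
  shows "diagonal_mat (jordan_matrix n_as)"
  using assms
proof (induction n_as)
  case Nil
  then show ?case by (simp add: jordan_matrix_def diagonal_mat_def)
next
  case (Cons na n_as)
  obtain n a where na: "na = (n, a)" by force
  have "diagonal_mat (jordan_matrix n_as)" using Cons.prems by (intro Cons.IH) auto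
  moreover have "n \<le> 1" using Cons.prems[of n a] na by simp
  ultimately show ?case
    unfolding na jordan_matrix_Cons diagonal_mat_def by (auto simp: less_Suc_eq)
qed

text \<open>The diagonal form is the Jordan form, all of whose blocks turn out to have size at most
  1. Orthogonality of \<open>P\<close> is not claimed; below, the rows of its inverse
  \<open>Q\<close> serve as the dual basis of the columns of \<open>P\<close>.\<close>

lemma symmetric_similar_diagonal:
  fixes A :: "real mat"
  assumes A: "A \<in> carrier_mat n n" and sym: "transpose_mat A = A"
  obtains D P Q where "similar_mat_wit A D P Q" "diagonal_mat D"
proof -
  obtain n_as where jnf: "jordan_nf A n_as"
    using symmetric_char_poly_splits[OF A sym] jordan_nf_exists[OF A] by blast
  have "k \<le> 1" if ka: "(k, a) \<in> set n_as" for k a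
  proof -
    \<comment> \<open>Since \<open>A - a\<close> is symmetric, its square has the same kernel, which excludes larger Jordan blocks.\<close>
    let ?C = "char_matrix A a"
    have C: "?C \<in> carrier_mat n n" using A by simp
    have symC: "transpose_mat ?C = ?C"
    proof (rule eq_matI)
      fix i j assume "i < dim_row ?C" "j < dim_col ?C"
      then have ij: "i < n" "j < n" using C by auto
      then have "A $$ (j, i) = A $$ (i, j)" using A sym by (metis carrier_matD index_transpose_mat(1))
      then show "transpose_mat ?C $$ (i, j) = ?C $$ (i, j)"
        unfolding char_matrix_def using A ij by simp
    qed (use C in auto)
    have "mat_kernel (?C * ?C) = mat_kernel ?C"
    proof (intro equalityI subsetI)
      fix v assume "v \<in> mat_kernel (?C * ?C)"
      then have v: "v \<in> carrier_vec n" and z: "(?C * ?C) *\<^sub>v v = 0\<^sub>v n"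
        using mat_kernel[of "?C * ?C" n n] C by auto
      have Cv: "?C *\<^sub>v v \<in> carrier_vec n" using C v by simp
      \<comment> \<open>By symmetry the squared norm of \<open>?C *\<^sub>v v\<close> is the product
        of \<open>?C * ?C\<close> applied to \<open>v\<close> with \<open>v\<close> itself.\<close>
      have "(?C *\<^sub>v v) \<bullet> (?C *\<^sub>v v) = (transpose_mat ?C *\<^sub>v (?C *\<^sub>v v)) \<bullet> v"
        using transpose_vec_mult_scalar[OF C v Cv] by simp
      also have "\<dots> = 0" using z C v symC by simp
      finally have "?C *\<^sub>v v = 0\<^sub>v n" using real_scalar_prod_self_eq_0D[OF Cv] by simp
      then show "v \<in> mat_kernel ?C" using mat_kernel[OF C] v by simp
    next
      fix v assume "v \<in> mat_kernel ?C"
      then have v: "v \<in> carrier_vec n" and z: "?C *\<^sub>v v = 0\<^sub>v n"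
        using mat_kernel[OF C] by auto
      have "(?C * ?C) *\<^sub>v v = 0\<^sub>v n"
        using C v z by (simp, intro eq_vecI, auto)
      then show "v \<in> mat_kernel (?C * ?C)" using mat_kernel[of "?C * ?C" n n] C v by simp
    qed
    moreover have "?C ^\<^sub>m 1 = ?C" "?C ^\<^sub>m 2 = ?C * ?C" using C by (simp_all add: numeral_2_eq_2)
    ultimately have "dim_gen_eigenspace A a 2 = dim_gen_eigenspace A a 1"
      unfolding dim_gen_eigenspace_def kernel_dim_def using C by simp
    \<comment> \<open>The kernel of the \<open>j\<close>-th power of \<open>?C\<close> has as
      dimension the sum of \<open>min j n\<close> over the sizes \<open>n\<close> of the blocks for
      \<open>a\<close>. From \<open>j = 1\<close> to \<open>j = 2\<close> it grows by one for each
      block of size at least 2.\<close>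
    then have eq: "(\<Sum>n\<leftarrow>map fst [(n, e)\<leftarrow>n_as . e = a]. min 2 n)
        = (\<Sum>n\<leftarrow>map fst [(n, e)\<leftarrow>n_as . e = a]. min 1 n)"
      unfolding dim_gen_eigenspace[OF jnf] .
    have "\<forall>n\<in>set ns. n \<le> 1" if "(\<Sum>n\<leftarrow>ns. min 2 n) = (\<Sum>n\<leftarrow>ns. min 1 n)" for ns :: "nat list"
      using that
    proof (induction ns)
      case (Cons x xs)
      have "(\<Sum>n\<leftarrow>xs. min 1 n) \<le> (\<Sum>n\<leftarrow>xs. min 2 n)" by (rule sum_list_mono) simp
      then show ?case using Cons by (auto simp: min_def split: if_splits)
    qed simp
    from this[OF eq] show ?thesis using ka by force
  qed
  then have "diagonal_mat (jordan_matrix n_as)" by (rule jordan_matrix_diagonal)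
  then show ?thesis using jnf that unfolding jordan_nf_def similar_mat_def by blast
qed

section \<open>Eigenvalues of Gram matrices\<close>

lemma index_mult_mat_sum:
  assumes "A \<in> carrier_mat n m" "B \<in> carrier_mat m l" "i < n" "j < l"
  shows "(A * B) $$ (i, j) = (\<Sum>k<m. A $$ (i, k) * B $$ (k, j))"
  using assms by (simp add: scalar_prod_def atLeast0LessThan)

lemma similar_diagonal_mult_col:
  fixes A :: "real mat"
  assumes A: "A \<in> carrier_mat n n" and wit: "similar_mat_wit A D P Q"
    and diag: "diagonal_mat D" and i: "i < n"
  shows "A *\<^sub>v col P i = D $$ (i, i) \<cdot>\<^sub>v col P i"
proof -
  note w = similar_mat_witD2[OF A wit]
  have "A * P = P * D * (Q * P)"
    using w(3) assoc_mult_mat[OF mult_carrier_mat[OF w(6,5)] w(7,6)] by simp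
  also have "\<dots> = P * D" using w by simp
  finally have AP: "A * P = P * D" .
  have "A *\<^sub>v col P i = col (A * P) i" by (rule col_mult2[OF A w(6) i, symmetric])
  also have "\<dots> = D $$ (i, i) \<cdot>\<^sub>v col P i"
  proof (rule eq_vecI)
    fix j assume "j < dim_vec (D $$ (i, i) \<cdot>\<^sub>v col P i)"
    then have j: "j < n" using w(6) by simp
    have "col (A * P) i $ j = (\<Sum>l<n. P $$ (j, l) * D $$ (l, i))"
      unfolding AP using w i j by (simp add: scalar_prod_def atLeast0LessThan)
    also have "\<dots> = (\<Sum>l<n. if l = i then P $$ (j, i) * D $$ (i, i) else 0)"
      by (rule sum.cong) (use diag w(5) i in \<open>auto simp: diagonal_mat_def\<close>)
    finally show "col (A * P) i $ j = (D $$ (i, i) \<cdot>\<^sub>v col P i) $ j"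
      using w(6) i j by simp
  qed (use w A in auto)
  finally show ?thesis .
qed

text \<open>From \<open>A = P * D * Q\<close> and \<open>Q * P = 1\<close> follows
  \<open>Q * A = D * Q\<close>: row \<open>i\<close> of \<open>Q\<close> is the \<open>i\<close>-th
  coordinate functional for the eigenbasis in the columns of \<open>P\<close>, and a left
  eigenvector.\<close>

lemma similar_diagonal_mult_row:
  fixes A :: "real mat"
  assumes A: "A \<in> carrier_mat n n" and wit: "similar_mat_wit A D P Q"
    and diag: "diagonal_mat D" and ij: "i < n" "j < n"
  shows "(Q * A) $$ (i, j) = D $$ (i, i) * Q $$ (i, j)"
proof -
  note w = similar_mat_witD2[OF A wit]
  have "Q * A = (Q * P) * (D * Q)"
    using w(3) assoc_mult_mat[OF w(6,5,7)] assoc_mult_mat[OF w(7,6) mult_carrier_mat[OF w(5,7)]] by simp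
  also have "\<dots> = D * Q" using w by simp
  finally have QA: "Q * A = D * Q" .
  have "(Q * A) $$ (i, j) = (\<Sum>l<n. D $$ (i, l) * Q $$ (l, j))"
    unfolding QA using w ij by (simp add: scalar_prod_def atLeast0LessThan)
  also have "\<dots> = (\<Sum>l<n. if l = i then D $$ (i, i) * Q $$ (i, j) else 0)"
    by (rule sum.cong) (use diag w(5) ij in \<open>auto simp: diagonal_mat_def\<close>)
  finally show ?thesis using ij by simp
qed

lemma similar_diagonal_trace:
  fixes A :: "real mat"
  assumes A: "A \<in> carrier_mat n n" and wit: "similar_mat_wit A D P Q" and diag: "diagonal_mat D"
  shows "(\<Sum>i<n. A $$ (i, i)) = (\<Sum>i<n. D $$ (i, i))"
proof -
  note w = similar_mat_witD2[OF A wit]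
  have PQA: "P * (Q * A) = A" using assoc_mult_mat[OF w(6,7) A] w(1) A by simp
  have "(P * (Q * A)) $$ (i, i) = (\<Sum>l<n. P $$ (i, l) * (Q * A) $$ (l, i))" if "i < n" for i
    by (rule index_mult_mat_sum[OF w(6) mult_carrier_mat[OF w(7) A] that that])
  then have "(\<Sum>i<n. A $$ (i, i)) = (\<Sum>i<n. \<Sum>l<n. D $$ (l, l) * (Q $$ (l, i) * P $$ (i, l)))"
    using similar_diagonal_mult_row[OF A wit diag]
    by (simp add: PQA mult_ac del: index_mult_mat(1))
  also have "\<dots> = (\<Sum>l<n. D $$ (l, l) * (Q * P) $$ (l, l))"
    by (subst sum.swap) (use w(6,7) in \<open>simp add: scalar_prod_def atLeast0LessThan sum_distrib_left\<close>)
  also have "\<dots> = (\<Sum>l<n. D $$ (l, l))" using w(2) by simp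
  finally show ?thesis .
qed

lemma proots_linear_factors:
  fixes as :: "'a :: idom list"
  shows "proots (\<Prod>a\<leftarrow>as. [:- a, 1:]) = mset as"
proof (induction as)
  case (Cons a as)
  have "(\<Prod>a\<leftarrow>as. [:- a, 1:]) \<noteq> 0" by (auto simp: prod_list_zero_iff)
  then show ?case using Cons by (simp add: proots_mult del: mult_pCons_left)
qed simp

text \<open>Similar matrices share their characteristic polynomial. This identifies the multiset of
  eigenvalues, with multiplicity, with the diagonal of \<open>D\<close>.\<close>

lemma similar_diagonal_proots:
  fixes A :: "real mat"
  assumes A: "A \<in> carrier_mat n n" and wit: "similar_mat_wit A D P Q" and diag: "diagonal_mat D"
  shows "proots (char_poly A) = mset (map (\<lambda>i. D $$ (i, i)) [0..<n])"
proof -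
  note w = similar_mat_witD2[OF A wit]
  have "char_poly A = char_poly D"
    using wit char_poly_similar unfolding similar_mat_def by blast
  also have "\<dots> = (\<Prod>a\<leftarrow>diag_mat D. [:- a, 1:])"
    by (rule char_poly_upper_triangular[OF w(5)])
      (use diag w(5) in \<open>auto simp: diagonal_mat_def\<close>)
  finally have "proots (char_poly A) = proots (\<Prod>a\<leftarrow>diag_mat D. [:- a, 1:])" by simp
  also have "\<dots> = mset (diag_mat D)" by (rule proots_linear_factors)
  finally show ?thesis using w(5) by (simp add: diag_mat_def)
qed

text \<open>A diagonalizable matrix satisfies a polynomial equation exactly when its eigenvalues do.
  For \<open>x * x = c * x\<close> this translates "all nonzero eigenvalues equal \<open>c\<close>"
  into an identity between matrix entries, and back.\<close>

lemma similar_diagonal_quadratic: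
  fixes A :: "real mat"
  assumes A: "A \<in> carrier_mat n n" and wit: "similar_mat_wit A D P Q" and diag: "diagonal_mat D"
  shows "A * A = c \<cdot>\<^sub>m A \<longleftrightarrow> (\<forall>i<n. D $$ (i, i) = 0 \<or> D $$ (i, i) = c)"
proof
  note w = similar_mat_witD2[OF A wit]
  assume sq: "A * A = c \<cdot>\<^sub>m A"
  show "\<forall>i<n. D $$ (i, i) = 0 \<or> D $$ (i, i) = c"
  proof (intro allI impI)
    fix i assume i: "i < n"
    let ?d = "D $$ (i, i)" and ?v = "col P i"
    have v: "?v \<in> carrier_vec n" using w(6) i by simp
    have Av: "A *\<^sub>v ?v = ?d \<cdot>\<^sub>v ?v" by (rule similar_diagonal_mult_col[OF A wit diag i])
    have "(A * A) *\<^sub>v ?v = (?d * ?d) \<cdot>\<^sub>v ?v"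
      using A v Av by (simp add: mult_mat_vec smult_smult_assoc)
    moreover have "(c \<cdot>\<^sub>m A) *\<^sub>v ?v = c \<cdot>\<^sub>v (A *\<^sub>v ?v)"
      by (rule eq_vecI) (use A v in \<open>auto simp: smult_scalar_prod_distrib[of _ n]\<close>)
    ultimately have eq: "(?d * ?d) \<cdot>\<^sub>v ?v = (c * ?d) \<cdot>\<^sub>v ?v" using sq Av by (simp add: smult_smult_assoc)
    \<comment> \<open>Pairing with the dual row of \<open>Q\<close> extracts the scalar factors,
      since the product with \<open>?v\<close> is 1.\<close>
    have "(Q * P) $$ (i, i) = row Q i \<bullet> ?v" using w(6,7) i by simp
    then have q: "row Q i \<bullet> ?v = 1" using w(2) i by simp
    have "row Q i \<in> carrier_vec n" using w(7) i by simp
    then have "?d * ?d = c * ?d" using arg_cong[OF eq, of "\<lambda>x. row Q i \<bullet> x"] v q by simp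
    then show "?d = 0 \<or> ?d = c" by simp
  qed
next
  note w = similar_mat_witD2[OF A wit]
  assume d: "\<forall>i<n. D $$ (i, i) = 0 \<or> D $$ (i, i) = c"
  have QA: "Q * A \<in> carrier_mat n n" using A w(7) by simp
  have row: "(Q * A * A) $$ (i, j) = c * (Q * A) $$ (i, j)" if ij: "i < n" "j < n" for i j
  proof -
    have "(Q * A * A) $$ (i, j) = (\<Sum>l<n. (Q * A) $$ (i, l) * A $$ (l, j))"
      by (rule index_mult_mat_sum[OF QA A ij])
    also have "\<dots> = (\<Sum>l<n. D $$ (i, i) * (Q $$ (i, l) * A $$ (l, j)))"
      using similar_diagonal_mult_row[OF A wit diag ij(1)] by (simp add: mult_ac del: index_mult_mat(1))
    also have "\<dots> = D $$ (i, i) * (Q * A) $$ (i, j)"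
      using w(7) A ij by (simp add: scalar_prod_def atLeast0LessThan sum_distrib_left)
    \<comment> \<open>If the eigenvalue is 0, row \<open>i\<close> of \<open>Q * A\<close> vanishes,
      so the factor may be replaced by \<open>c\<close> in either case.\<close>
    also have "\<dots> = c * (Q * A) $$ (i, j)"
      using similar_diagonal_mult_row[OF A wit diag ij] d ij by (auto simp del: index_mult_mat(1))
    finally show ?thesis .
  qed
  have QAA: "Q * A * A = c \<cdot>\<^sub>m (Q * A)"
  proof (rule eq_matI)
    fix i j assume "i < dim_row (c \<cdot>\<^sub>m (Q * A))" "j < dim_col (c \<cdot>\<^sub>m (Q * A))"
    then have ij: "i < n" "j < n" using w(7) A by auto
    then have "(c \<cdot>\<^sub>m (Q * A)) $$ (i, j) = c * (Q * A) $$ (i, j)"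
      using w(7) A by (intro index_smult_mat(1)) auto
    with row[OF ij] show "(Q * A * A) $$ (i, j) = (c \<cdot>\<^sub>m (Q * A)) $$ (i, j)" by (simp only:)
  qed (use w(7) A in auto)
  have PQA: "P * (Q * A) = A" using assoc_mult_mat[OF w(6,7) A] w(1) A by simp
  have "A * A = P * (Q * A) * A" by (simp only: PQA)
  also have "\<dots> = P * (Q * A * A)" by (rule assoc_mult_mat[OF w(6) QA A])
  also have "\<dots> = c \<cdot>\<^sub>m (P * (Q * A))"
    unfolding QAA by (rule mult_smult_distrib[OF w(6) QA])
  also have "P * (Q * A) = A" by (fact PQA)
  finally show "A * A = c \<cdot>\<^sub>m A" .
qed

text \<open>For an eigenvector \<open>v\<close>, the eigenvalue times \<open>v \<bullet> v\<close>
  is the squared norm of \<open>transpose_mat B *\<^sub>v v\<close>.\<close>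

lemma gram_diagonal_nonneg:
  fixes B :: "real mat"
  assumes B: "B \<in> carrier_mat n m" and wit: "similar_mat_wit (B * transpose_mat B) D P Q"
    and diag: "diagonal_mat D" and i: "i < n"
  shows "D $$ (i, i) \<ge> 0"
proof -
  let ?A = "B * transpose_mat B"
  have A: "?A \<in> carrier_mat n n" using B by simp
  note w = similar_mat_witD2[OF A wit]
  let ?v = "col P i"
  have v: "?v \<in> carrier_vec n" using w(6) i by simp
  let ?u = "transpose_mat B *\<^sub>v ?v"
  have u: "?u \<in> carrier_vec m" using B v by simp
  have sq: "x \<bullet> x \<ge> 0" for x :: "real vec" by (simp add: scalar_prod_def sum_nonneg)
  have "D $$ (i, i) * (?v \<bullet> ?v) = ?v \<bullet> (?A *\<^sub>v ?v)"
    using similar_diagonal_mult_col[OF A wit diag i] v by simp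
  also have "\<dots> = ?v \<bullet> (B *\<^sub>v ?u)"
    using B v by (simp add: assoc_mult_mat_vec[of B n m _ n])
  also have "\<dots> = ?u \<bullet> ?u" using transpose_vec_mult_scalar[OF B u v] by simp
  finally have eq: "D $$ (i, i) * (?v \<bullet> ?v) \<ge> 0" using sq by simp
  have "?v \<bullet> ?v \<noteq> 0"
  proof
    assume "?v \<bullet> ?v = 0"
    then have "?v = 0\<^sub>v n" by (rule real_scalar_prod_self_eq_0D[OF v])
    moreover have "(Q * P) $$ (i, i) = row Q i \<bullet> ?v" using w(6,7) i by simp
    moreover have "row Q i \<in> carrier_vec n" using w(7) i by simp
    ultimately have "(Q * P) $$ (i, i) = 0" by simp
    then show False using w(2) i by simp
  qed
  then have "?v \<bullet> ?v > 0" using sq[of ?v] by simp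
  then show ?thesis using eq by (simp add: zero_le_mult_iff)
qed

text \<open>The columns of \<open>P\<close> with nonzero eigenvalue form a basis of the column space
  of \<open>B\<close>. They are collected in \<open>S\<close>, and their independence is inherited
  from the invertible \<open>P\<close>.\<close>

lemma gram_rank:
  fixes B :: "real mat"
  assumes B: "B \<in> carrier_mat n m" and wit: "similar_mat_wit (B * transpose_mat B) D P Q"
    and diag: "diagonal_mat D"
  shows "vec_space.rank n B = card {i. i < n \<and> D $$ (i, i) \<noteq> 0}"
proof -
  interpret V: vec_space "TYPE(real)" n .
  let ?A = "B * transpose_mat B"
  have A: "?A \<in> carrier_mat n n" using B by simp
  note w = similar_mat_witD2[OF A wit]
  define js where "js = filter (\<lambda>i. D $$ (i, i) \<noteq> 0) [0..<n]"
  have js: "set js = {i. i < n \<and> D $$ (i, i) \<noteq> 0}" "distinct js"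
    unfolding js_def by auto
  define S where "S = mat_of_cols n (map (col P) js)"
  have S: "S \<in> carrier_mat n (length js)"
    unfolding S_def using mat_of_cols_carrier(1)[of n "map (col P) js"]
    by simp
  have "det P * det Q = 1" using det_mult[OF w(6,7)] w(1) by simp
  then have "V.rank P = n" using V.det_rank_iff[OF w(6)] by auto
  then have dP: "distinct (cols P)" and iP: "V.lin_indpt (set (cols P))"
    using V.non_distinct_low_rank[OF w(6)] V.full_rank_lin_indpt[OF w(6)] by auto
  have colsS: "cols S = map (col P) js"
    unfolding S_def
  proof (rule cols_mat_of_cols)
    show "set (map (col P) js) \<subseteq> carrier_vec n"
      unfolding set_map using col_dim[of P] w(6) by blast
  qed
  have "inj_on (col P) {..<n}"
    using dP w(6) by (auto simp: cols_def distinct_map atLeast0LessThan)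
  then have dS: "distinct (cols S)"
    unfolding colsS distinct_map using js by (auto intro: inj_on_subset)
  have "set (cols S) \<subseteq> set (cols P)" unfolding colsS using js w(6) by (auto simp: cols_def)
  then have iS: "V.lin_indpt (set (cols S))" using V.subset_li_is_li[OF iP] by blast
  have "V.rank S = length js" by (rule V.lin_indpt_full_rank[OF S dS iS])
  also have "\<dots> = card {i. i < n \<and> D $$ (i, i) \<noteq> 0}" using js distinct_card by metis
  finally have rS: "V.rank S = card {i. i < n \<and> D $$ (i, i) \<noteq> 0}" .
  \<comment> \<open>For eigenvalue 0 the left eigenvector \<open>?q\<close> is killed by
    \<open>?A\<close>, so \<open>B\<close> kills \<open>?u\<close>, which is the transpose of
    \<open>B\<close> applied to \<open>?q\<close>. Hence \<open>?u \<bullet> ?u\<close> equals the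
    product of \<open>B *\<^sub>v ?u\<close> with \<open>?q\<close>, which is 0.\<close>
  have zero: "(Q * B) $$ (i, j) = 0" if i: "i < n" and di: "D $$ (i, i) = 0" and j: "j < m" for i j
  proof -
    let ?q = "row Q i" and ?u = "row (Q * B) i"
    have q: "?q \<in> carrier_vec n" and u: "?u \<in> carrier_vec m" using w(7) B i by auto
    have QBB: "Q * B * transpose_mat B = Q * ?A"
      using w(7) B by (simp add: assoc_mult_mat[of Q n n B m _ n])
    have uq: "?u = transpose_mat B *\<^sub>v ?q"
      by (rule eq_vecI) (use w(7) B i in \<open>auto simp: comm_scalar_prod[of _ n]\<close>)
    have "B *\<^sub>v ?u = 0\<^sub>v n"
    proof (rule eq_vecI)
      fix l assume "l < dim_vec (0\<^sub>v n :: real vec)"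
      then have l: "l < n" by simp
      have "(B *\<^sub>v ?u) $ l = (Q * B * transpose_mat B) $$ (i, l)"
      proof -
        have "(B *\<^sub>v ?u) $ l = row B l \<bullet> ?u" using B l by simp
        also have "\<dots> = ?u \<bullet> row B l" by (rule comm_scalar_prod[of _ m]) (use B l u in auto)
        also have "\<dots> = ?u \<bullet> col (transpose_mat B) l" using B l by simp
        also have "\<dots> = (Q * B * transpose_mat B) $$ (i, l)"
          by (rule index_mult_mat(1)[symmetric]) (use B w(7) i l in auto)
        finally show ?thesis .
      qed
      also have "\<dots> = 0" unfolding QBB using similar_diagonal_mult_row[OF A wit diag i l] di
        by (simp del: index_mult_mat(1))
      finally show "(B *\<^sub>v ?u) $ l = 0\<^sub>v n $ l" using l by simp
    qed (use B in auto)
    then have "?u \<bullet> ?u = 0"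
      using transpose_vec_mult_scalar[OF B u q] uq q by simp
    then have "?u = 0\<^sub>v m" by (rule real_scalar_prod_self_eq_0D[OF u])
    then have "?u $ j = 0" using j by simp
    then show ?thesis using w(7) B i j by simp
  qed
  have "set (cols S) \<subseteq> V.col_space B"
  proof
    fix v assume "v \<in> set (cols S)"
    then obtain i where i: "i < n" "D $$ (i, i) \<noteq> 0" and v: "v = col P i"
      unfolding colsS using js by auto
    have vc: "v \<in> carrier_vec n" using v w(6) i by simp
    \<comment> \<open>An eigenvector \<open>v\<close> with eigenvalue \<open>d\<close> nonzero is
      \<open>(1 / d)\<close> times \<open>B\<close> applied to the transpose of \<open>B\<close>
      applied to \<open>v\<close>, hence lies in the column space of \<open>B\<close>.\<close>
    let ?x = "(1 / D $$ (i, i)) \<cdot>\<^sub>v (transpose_mat B *\<^sub>v v)"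
    have x: "?x \<in> carrier_vec m" using B vc by simp
    have "B *\<^sub>v ?x = (1 / D $$ (i, i)) \<cdot>\<^sub>v (?A *\<^sub>v v)"
      using B vc by (simp add: mult_mat_vec[of B n m] assoc_mult_mat_vec[of B n m _ n])
    also have "\<dots> = v"
      using similar_diagonal_mult_col[OF A wit diag i(1)] i vc v by (simp add: smult_smult_assoc)
    finally show "v \<in> V.col_space B" unfolding V.col_space_eq[OF B] using B x vc by auto
  qed
  moreover have "set (cols B) \<subseteq> V.col_space S"
  proof
    fix v assume "v \<in> set (cols B)"
    then obtain j where j: "j < m" and v: "v = col B j" using B by (auto simp: cols_def)
    have vc: "v \<in> carrier_vec n" using v B j by simp
    \<comment> \<open>The coordinates of column \<open>j\<close> of \<open>B\<close> in the
      eigenbasis; those dropped here are 0 by \<open>zero\<close>.\<close>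
    define x where "x = vec (length js) (\<lambda>l. (Q * B) $$ (js ! l, j))"
    have "S *\<^sub>v x = v"
    proof (rule eq_vecI)
      fix a assume "a < dim_vec v"
      then have a: "a < n" using vc by simp
      have Sa: "S $$ (a, l) = P $$ (a, js ! l)" if "l < length js" for l
      proof -
        have "js ! l < n" using js(1) that nth_mem by blast
        then show ?thesis unfolding S_def using a that w(6) by (simp add: mat_of_cols_index)
      qed
      have "(S *\<^sub>v x) $ a = (\<Sum>l<length js. P $$ (a, js ! l) * (Q * B) $$ (js ! l, j))"
        using S a Sa by (simp add: x_def scalar_prod_def atLeast0LessThan del: index_mult_mat(1))
      also have "\<dots> = (\<Sum>i\<in>set js. P $$ (a, i) * (Q * B) $$ (i, j))"
        by (rule sum.reindex_bij_betw) (rule bij_betw_nth[OF js(2)], auto)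
      also have "\<dots> = (\<Sum>i<n. P $$ (a, i) * (Q * B) $$ (i, j))"
        by (rule sum.mono_neutral_left) (use js(1) zero j in \<open>auto simp del: index_mult_mat(1)\<close>)
      also have "\<dots> = (P * (Q * B)) $$ (a, j)"
        by (rule index_mult_mat_sum[OF w(6) mult_carrier_mat[OF w(7) B] a j, symmetric])
      also have "P * (Q * B) = B" using assoc_mult_mat[OF w(6,7) B] w(1) B by simp
      finally show "(S *\<^sub>v x) $ a = v $ a" using v B a j by simp
    qed (use S vc in auto)
    moreover have "x \<in> carrier_vec (length js)" unfolding x_def by simp
    ultimately show "v \<in> V.col_space S" unfolding V.col_space_eq[OF S] using S vc by auto
  qed
  moreover have "set (cols S) \<subseteq> carrier_vec n" "set (cols B) \<subseteq> carrier_vec n"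
    using cols_dim[of S] cols_dim[of B] S B by auto
  ultimately have "V.span (set (cols S)) = V.span (set (cols B))"
    unfolding V.col_space_def by (intro equalityI V.span_subsetI) auto
  then have "V.rank S = V.rank B" unfolding V.rank_def by simp
  then show ?thesis using rS by simp
qed

section \<open>Nonnegative matrices and the Cauchy-Schwarz inequality\<close>

text \<open>One positive term in the sum for \<open>c * N u v\<close> makes \<open>N u v\<close>
  positive, so positivity of entries is transitive and columns \<open>i\<close> and \<open>j\<close>
  have the same support. Extremality of their ratio then makes them proportional at \<open>i\<close>
  and \<open>j\<close>, where the minor is read off.\<close>

lemma nonneg_quadratic_minor_eq:
  fixes N :: "nat \<Rightarrow> nat \<Rightarrow> real"
  assumes nonneg: "\<And>u v. N u v \<ge> 0" and sym: "\<And>u v. N u v = N v u"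
    and sq: "\<And>u v. u < n \<Longrightarrow> v < n \<Longrightarrow> (\<Sum>w<n. N u w * N w v) = c * N u v"
    and i: "i < n" and j: "j < n" and pos: "N i j > 0"
  shows "(N i j)\<^sup>2 = N i i * N j j"
proof -
  have trans: "N u v > 0" if "u < n" "w < n" "v < n" "N u w > 0" "N w v > 0" for u w v
  proof -
    have "N u w * N w v \<le> (\<Sum>w<n. N u w * N w v)"
      by (rule member_le_sum) (use that nonneg in auto)
    moreover have "N u w * N w v > 0" using that by simp
    ultimately have "c * N u v > 0" using sq[OF that(1,3)] by linarith
    then show ?thesis using nonneg[of u v] by (auto simp: less_le)
  qed
  define S where "S = {l. l < n \<and> N i l > 0}"
  have S: "finite S" "S \<noteq> {}" using j pos by (auto simp: S_def)
  have jS: "N j l > 0" if "l \<in> S" for l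
    using trans[of j i l] that i j pos sym[of i j] by (auto simp: S_def)
  \<comment> \<open>Subtract from column \<open>i\<close> the largest multiple of column \<open>j\<close> that keeps it nonnegative: the
    result is a nonnegative eigenvector with a zero in the component of \<open>i\<close>, so it vanishes there.\<close>
  obtain p where p: "p \<in> S" and min: "\<And>l. l \<in> S \<Longrightarrow> N i p / N j p \<le> N i l / N j l"
    using S arg_min_if_finite[of S "\<lambda>l. N i l / N j l"] by (meson not_le_imp_less)
  define t where "t = N i p / N j p"
  define z where "z l = N i l - t * N j l" for l
  have z: "z l \<ge> 0" if "l < n" for l
  proof (cases "l \<in> S")
    case True
    then show ?thesis using min[OF True] jS[OF True] by (simp add: z_def t_def pos_le_divide_eq)
  next
    case False
    then have "\<not> N i l > 0" using that by (simp add: S_def)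
    \<comment> \<open>Off the common support both columns vanish: \<open>N j l > 0\<close> together
      with \<open>N i j > 0\<close> would put \<open>l\<close> into \<open>S\<close>.\<close>
    moreover from this have "\<not> N j l > 0" using trans[of i j l] i j pos that by auto
    ultimately show ?thesis using nonneg[of i l] nonneg[of j l] by (simp add: z_def)
  qed
  have zp: "z p = 0" using jS[OF p] by (simp add: z_def t_def)
  have pn: "p < n" using p by (simp add: S_def)
  have "(\<Sum>l<n. N p l * z l) = (\<Sum>l<n. N i l * N l p) - t * (\<Sum>l<n. N j l * N l p)"
    by (simp add: z_def algebra_simps sum_subtractf sum_distrib_left sym[of p])
  also have "\<dots> = c * z p" unfolding sq[OF i pn] sq[OF j pn] by (simp add: z_def algebra_simps)
  finally have "(\<Sum>l<n. N p l * z l) = 0" using zp by simp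
  then have zero: "N p l * z l = 0" if "l < n" for l
    using that z nonneg by (subst (asm) sum_nonneg_eq_0_iff) auto
  have "N p i > 0" "N p j > 0" using p jS[OF p] sym by (auto simp: S_def)
  then have "z i = 0" "z j = 0" using zero[OF i] zero[OF j] by auto
  then have "N i i = t * N i j" "N i j = t * N j j" using sym[of i j] by (auto simp: z_def)
  then show ?thesis by (simp add: power2_eq_square)
qed

text \<open>Cauchy-Schwarz against the constant vector, via the variance identity \<open>id\<close>.
  Scaling the deviations by \<open>?r\<close> avoids a division by 0 for empty \<open>I\<close>; in
  the equality case all deviations from the mean vanish.\<close>

lemma sum_power2_le_card:
  fixes x :: "'b \<Rightarrow> real"
  assumes "finite I"
  shows "(\<Sum>i\<in>I. x i)\<^sup>2 \<le> card I * (\<Sum>i\<in>I. (x i)\<^sup>2)"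
    and "(\<Sum>i\<in>I. x i)\<^sup>2 = card I * (\<Sum>i\<in>I. (x i)\<^sup>2) \<Longrightarrow> i \<in> I \<Longrightarrow> x i = (\<Sum>i\<in>I. x i) / card I"
proof -
  let ?r = "real (card I)" and ?s = "\<Sum>i\<in>I. x i" and ?q = "\<Sum>i\<in>I. (x i)\<^sup>2"
  have "(\<Sum>i\<in>I. (?r * x i - ?s)\<^sup>2) = (\<Sum>i\<in>I. ?r\<^sup>2 * (x i)\<^sup>2 - 2 * ?r * ?s * x i + ?s\<^sup>2)"
    by (rule sum.cong) (auto simp: power2_eq_square algebra_simps)
  also have "\<dots> = ?r\<^sup>2 * ?q - 2 * ?r * ?s * ?s + ?r * ?s\<^sup>2"
    by (simp add: sum.distrib sum_subtractf sum_distrib_left)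
  finally have id: "(\<Sum>i\<in>I. (?r * x i - ?s)\<^sup>2) = ?r * (?r * ?q - ?s\<^sup>2)"
    by (simp add: power2_eq_square algebra_simps)
  show "?s\<^sup>2 \<le> ?r * ?q"
  proof (cases "I = {}")
    case False
    then have "?r > 0" using assms by (simp add: card_gt_0_iff)
    moreover have "?r * (?r * ?q - ?s\<^sup>2) \<ge> 0" unfolding id[symmetric] by (simp add: sum_nonneg)
    ultimately show ?thesis by (simp add: zero_le_mult_iff)
  qed simp
  assume eq: "?s\<^sup>2 = ?r * ?q" and i: "i \<in> I"
  have "(\<Sum>i\<in>I. (?r * x i - ?s)\<^sup>2) = 0" unfolding id eq by simp
  then have "(?r * x i - ?s)\<^sup>2 = 0" using assms i by (subst (asm) sum_nonneg_eq_0_iff) auto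
  moreover have "?r > 0" using assms i by (auto simp: card_gt_0_iff)
  ultimately show "x i = ?s / ?r" by (simp add: field_simps)
qed

section \<open>Incidence matrices\<close>

lemma incidence_matrix_carrier [simp]:
  "incidence_matrix vs es \<in> carrier_mat (length vs) (length es)"
  by (simp add: incidence_matrix_def)

lemma dim_incidence_matrix [simp]:
  "dim_row (incidence_matrix vs es) = length vs" "dim_col (incidence_matrix vs es) = length es"
  by (simp_all add: incidence_matrix_def)

lemma incidence_matrix_index [simp]:
  "u < length vs \<Longrightarrow> j < length es \<Longrightarrow>
    incidence_matrix vs es $$ (u, j) = of_bool (vs ! u \<in> es ! j)"
  by (simp add: incidence_matrix_def)

lemma sum_of_bool_nth:
  assumes "distinct vs" and "X \<subseteq> set vs"
  shows "(\<Sum>u<length vs. of_bool (vs ! u \<in> X)) = real (card X)"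
proof -
  have "(\<Sum>u<length vs. of_bool (vs ! u \<in> X)) = (\<Sum>v\<in>set vs. of_bool (v \<in> X) :: real)"
    by (rule sum.reindex_bij_betw) (use assms in \<open>auto intro: bij_betw_nth\<close>)
  also have "\<dots> = card X" using assms by (simp add: Int_absorb1 flip: Int_def)
  finally show ?thesis .
qed

text \<open>Double counting of incidences: diagonal entries are vertex degrees, and each edge
  contributes \<open>k\<close>.\<close>

lemma incidence_gram_trace:
  assumes "distinct vs" and "\<And>e. e \<in> set es \<Longrightarrow> e \<subseteq> set vs \<and> card e = k"
  shows "(\<Sum>u<length vs. (incidence_matrix vs es * transpose_mat (incidence_matrix vs es)) $$ (u, u))
    = real k * real (length es)"
proof -
  let ?B = "incidence_matrix vs es"
  have B: "?B \<in> carrier_mat (length vs) (length es)" by simp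
  have Bt: "transpose_mat ?B \<in> carrier_mat (length es) (length vs)" using B by simp
  have "(\<Sum>u<length vs. (?B * transpose_mat ?B) $$ (u, u))
    = (\<Sum>u<length vs. \<Sum>j<length es. of_bool (vs ! u \<in> es ! j))"
    using B by (intro sum.cong refl, subst index_mult_mat_sum[OF B Bt]) (auto intro!: sum.cong)
  also have "\<dots> = (\<Sum>j<length es. \<Sum>u<length vs. of_bool (vs ! u \<in> es ! j))"
    by (rule sum.swap)
  also have "\<dots> = (\<Sum>j<length es. real k)"
  proof (intro sum.cong refl)
    fix j assume "j \<in> {..<length es}"
    then have "es ! j \<subseteq> set vs" "card (es ! j) = k" using assms(2)[of "es ! j"] by auto
    then show "(\<Sum>u<length vs. of_bool (vs ! u \<in> es ! j)) = real k"
      using sum_of_bool_nth[OF assms(1)] by metis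
  qed
  finally show ?thesis by simp
qed

lemma incidence_gram_disjoint:
  assumes vs: "distinct vs" and es: "distinct es"
    and e: "\<And>e. e \<in> set es \<Longrightarrow> e \<subseteq> set vs \<and> card e = k"
    and disj: "pairwise disjnt (set es)"
  defines "A \<equiv> incidence_matrix vs es * transpose_mat (incidence_matrix vs es)"
  shows "A * A = real k \<cdot>\<^sub>m A"
proof -
  define B where "B = incidence_matrix vs es"
  let ?n = "length vs" and ?m = "length es"
  have B: "B \<in> carrier_mat ?n ?m" by (simp add: B_def)
  have Bt: "transpose_mat B \<in> carrier_mat ?m ?n" using B by simp
  have BtB: "transpose_mat B * B = real k \<cdot>\<^sub>m 1\<^sub>m ?m"
  proof (rule eq_matI)
    fix i j assume "i < dim_row (real k \<cdot>\<^sub>m 1\<^sub>m ?m)" "j < dim_col (real k \<cdot>\<^sub>m 1\<^sub>m ?m)"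
    then have ij: "i < ?m" "j < ?m" by auto
    have "(transpose_mat B * B) $$ (i, j) = (\<Sum>u<?n. of_bool (vs ! u \<in> es ! i \<inter> es ! j))"
      using B ij
      by (subst index_mult_mat_sum[OF Bt B]) (auto simp: B_def simp flip: of_bool_conj intro!: sum.cong)
    also have "\<dots> = real (card (es ! i \<inter> es ! j))"
      by (rule sum_of_bool_nth[OF vs]) (use e[of "es ! i"] ij in auto)
    also have "\<dots> = (if i = j then real k else 0)"
    proof (cases "i = j")
      case False
      \<comment> \<open>Distinctness of the listing makes different indices name different, hence
        disjoint, edges.\<close>
      then have "es ! i \<noteq> es ! j" using es ij by (simp add: nth_eq_iff_index_eq)
      then have "es ! i \<inter> es ! j = {}"
        using disj ij by (simp add: pairwise_def disjnt_def)
      then show ?thesis using False by simp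
    qed (use e ij in auto)
    finally show "(transpose_mat B * B) $$ (i, j) = (real k \<cdot>\<^sub>m 1\<^sub>m ?m) $$ (i, j)"
      using ij by simp
  qed (use B in auto)
  have "A * A = B * (transpose_mat B * (B * transpose_mat B))"
    unfolding A_def B_def[symmetric] by (rule assoc_mult_mat[OF B Bt mult_carrier_mat[OF B Bt]])
  also have "transpose_mat B * (B * transpose_mat B) = transpose_mat B * B * transpose_mat B"
    by (rule assoc_mult_mat[OF Bt B Bt, symmetric])
  also have "\<dots> = real k \<cdot>\<^sub>m transpose_mat B"
    unfolding BtB using Bt by (simp add: mult_smult_assoc_mat[of _ ?m ?m])
  also have "B * \<dots> = real k \<cdot>\<^sub>m A"
    unfolding A_def B_def[symmetric] by (rule mult_smult_distrib[OF B Bt])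
  finally show ?thesis .
qed

lemma incidence_gram_quadratic_imp_disjoint:
  assumes vs: "distinct vs"
    and e: "\<And>e. e \<in> set es \<Longrightarrow> e \<subseteq> set vs \<and> card e = k"
  defines "A \<equiv> incidence_matrix vs es * transpose_mat (incidence_matrix vs es)"
  assumes sq: "A * A = c \<cdot>\<^sub>m A"
  shows "pairwise disjnt (set es)"
proof -
  let ?n = "length vs" and ?m = "length es"
  \<comment> \<open>\<open>N\<close> extends the entries of \<open>A\<close> to all pairs of
    indices, so that nonnegativity and symmetry hold without range conditions, as the minor lemma
    asks.\<close>
  define b where "b u j = (of_bool (vs ! u \<in> es ! j) :: real)" for u j
  define N where "N u v = (\<Sum>j<?m. b u j * b v j)" for u v
  have B: "incidence_matrix vs es \<in> carrier_mat ?n ?m" by simp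
  have A: "A \<in> carrier_mat ?n ?n" unfolding A_def by (rule mult_carrier_mat[OF B]) simp
  have AN: "A $$ (u, v) = N u v" if "u < ?n" "v < ?n" for u v
    unfolding A_def N_def b_def using B that
    by (subst index_mult_mat_sum[OF B, of _ ?n]) (auto intro!: sum.cong)
  have b: "0 \<le> b u j" "b u j \<le> 1" "b u j * b u j = b u j" for u j by (auto simp: b_def)
  have nonneg: "N u v \<ge> 0" for u v unfolding N_def using b by (simp add: sum_nonneg)
  have sym: "N u v = N v u" for u v unfolding N_def by (simp add: mult.commute)
  have sqN: "(\<Sum>w<?n. N u w * N w v) = c * N u v" if "u < ?n" "v < ?n" for u v
  proof -
    have "(\<Sum>w<?n. N u w * N w v) = (A * A) $$ (u, v)"
      using index_mult_mat_sum[OF A A that] AN that by simp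
    also have "\<dots> = c * N u v" unfolding sq using A AN that by simp
    finally show ?thesis .
  qed
  have le: "N u v \<le> N u u" for u v
    unfolding N_def by (intro sum_mono) (auto simp: b_def)
  \<comment> \<open>Once \<open>u\<close> and \<open>v\<close> share the edge \<open>i\<close>,
    every edge through \<open>u\<close> contains \<open>v\<close>: the vanishing minor and
    \<open>N u v \<le> N v v\<close> give \<open>N u u \<le> N u v\<close>, so no edge through
    \<open>u\<close> misses \<open>v\<close>.\<close>
  have same: "vs ! v \<in> es ! j"
    if "u < ?n" "v < ?n" "i < ?m" "vs ! u \<in> es ! i" "vs ! v \<in> es ! i" "j < ?m" "vs ! u \<in> es ! j"
    for u v i j
  proof -
    have "b u i * b v i \<le> N u v"
      unfolding N_def by (rule member_le_sum) (use that b in auto)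
    then have pos: "N u v > 0" using that by (simp add: b_def)
    have "N u v * N u v = N u u * N v v"
      using nonneg_quadratic_minor_eq[OF nonneg sym sqN that(1,2) pos] by (simp add: power2_eq_square)
    moreover have "N u v * N u v \<le> N u v * N v v"
      using le[of v u] sym[of u v] nonneg by (intro mult_left_mono) auto
    moreover have "N v v > 0" using le[of v u] sym[of u v] pos by simp
    ultimately have "N u u \<le> N u v" by simp
    then have "(\<Sum>j<?m. b u j - b u j * b v j) = 0"
      using le[of u v] by (simp add: N_def sum_subtractf b(3))
    moreover have "b u j - b u j * b v j \<ge> 0" for j by (simp add: b_def)
    ultimately have "b u j - b u j * b v j = 0"
      using that by (subst (asm) sum_nonneg_eq_0_iff) auto
    then show ?thesis using that by (simp add: b_def split: if_splits)
  qed
  have sub: "e \<subseteq> f" if ef: "e \<in> set es" "f \<in> set es" "x \<in> e" "x \<in> f" for e f x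
  proof
    fix y assume y: "y \<in> e"
    obtain i j where ij: "i < ?m" "e = es ! i" "j < ?m" "f = es ! j"
      using ef by (auto simp: in_set_conv_nth)
    have "x \<in> set vs" "y \<in> set vs" using e ef y by auto
    then obtain u v where "u < ?n" "x = vs ! u" "v < ?n" "y = vs ! v"
      by (auto simp: in_set_conv_nth)
    then show "y \<in> f" using same[of u v i j] ij ef y by simp
  qed
  show ?thesis
    unfolding pairwise_def disjnt_def using sub by (metis disjoint_iff subset_antisym)
qed

section \<open>The two bounds and their equality cases\<close>

theorem theorem14:
  fixes V :: "'a set" and E :: "'a set set"
    and vs :: "'a list" and es :: "'a set list"
    and k m r :: nat and B :: "real mat"
  assumes "uniform_hypergraph k V E"
    and "lists_set vs V" and "lists_set es E"
    and "m = card E"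
    and "B = incidence_matrix vs es"
    and "r = vec_space.rank (card V) B"
  shows "incidence_energy vs es \<le> sqrt (real k * real m * real r) \<and>
    sqrt (real k * real m * real r) \<le> sqrt (real k) * real m \<and>
    (incidence_energy vs es = sqrt (real k * real m * real r) \<longleftrightarrow> pairwise disjnt E) \<and>
    (incidence_energy vs es = sqrt (real k) * real m \<longleftrightarrow> pairwise disjnt E)"
proof (cases "es = []")
  case True
  \<comment> \<open>Without edges \<open>m\<close> is 0, so the energy and both bounds are 0, and
    disjointness is vacuous.\<close>
  then show ?thesis using assms by (simp add: lists_set_def incidence_energy_def)
next
  case False
  have vs: "distinct vs" "set vs = V" and es: "distinct es" "set es = E"
    using assms by (auto simp: lists_set_def)
  have e: "e \<subseteq> set vs \<and> card e = k" if "e \<in> set es" for e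
    using assms(1) that vs es by (auto simp: uniform_hypergraph_def hypergraph_def)
  have k: "k > 0" using assms(1) by (simp add: uniform_hypergraph_def)
  define n where "n = length vs"
  have n: "n = card V" and m: "m = length es"
    using vs es distinct_card[of vs] distinct_card[of es] assms(4) by (auto simp: n_def)
  define A where "A = B * transpose_mat B"
  have B: "B \<in> carrier_mat n m" by (simp add: assms(5) n_def m)
  have A: "A \<in> carrier_mat n n" using B by (simp add: A_def)
  have "transpose_mat A = A" unfolding A_def using B by (subst transpose_mult) auto
  from symmetric_similar_diagonal[OF A this] obtain D P Q
    where wit: "similar_mat_wit A D P Q" and diag: "diagonal_mat D" .
  define d where "d i = D $$ (i, i)" for i
  \<comment> \<open>Restricting the sums to the nonzero eigenvalues makes Cauchy-Schwarz yield the
    factor \<open>r\<close> instead of \<open>n\<close>.\<close>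
  define I where "I = {i. i < n \<and> d i \<noteq> 0}"
  have I: "finite I" "I \<subseteq> {..<n}" by (auto simp: I_def)
  have d_nonneg: "d i \<ge> 0" if "i < n" for i
    using gram_diagonal_nonneg[OF B wit[unfolded A_def] diag that] by (simp add: d_def)
  have r: "r = card I"
    using gram_rank[OF B wit[unfolded A_def] diag] assms(6) n by (simp add: I_def d_def)
  have "r \<le> m" using vec_space.rank_le_nc[OF B] assms(6) n by simp
  have "real k * real m = (\<Sum>i<n. d i)"
    using similar_diagonal_trace[OF A wit diag] incidence_gram_trace[OF vs(1) e, where es = es]
    by (simp add: A_def assms(5) d_def n_def m)
  also have "\<dots> = (\<Sum>i\<in>I. d i)"
    by (rule sum.mono_neutral_right) (auto simp: I_def)
  finally have km: "(\<Sum>i\<in>I. d i) = real k * real m" by simp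
  define x where "x = incidence_energy vs es"
  have "x = \<Sum>\<^sub># (image_mset sqrt (proots (char_poly A)))"
    using False by (simp add: x_def incidence_energy_def singular_values_def A_def assms(5))
  also have "\<dots> = (\<Sum>i<n. sqrt (d i))"
    unfolding similar_diagonal_proots[OF A wit diag]
    by (simp add: d_def sum_mset_sum_list sum_list_sum_nth atLeast0LessThan flip: mset_map)
  also have "\<dots> = (\<Sum>i\<in>I. sqrt (d i))"
    by (rule sum.mono_neutral_right) (auto simp: I_def)
  finally have x: "x = (\<Sum>i\<in>I. sqrt (d i))" .
  have d_sqrt: "(sqrt (d i))\<^sup>2 = d i" if "i \<in> I" for i using d_nonneg[of i] that I by auto
  have sq: "(\<Sum>i\<in>I. (sqrt (d i))\<^sup>2) = real k * real m" using km d_sqrt by simp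
  have x2: "x\<^sup>2 \<le> real k * real m * real r"
    using sum_power2_le_card(1)[OF I(1), of "\<lambda>i. sqrt (d i)"] unfolding x sq r by (simp add: mult_ac)
  have le1: "x \<le> sqrt (real k * real m * real r)" using x2 by (rule real_le_rsqrt)
  have km2: "sqrt (real k * real m * real m) = sqrt (real k) * real m"
    by (simp add: real_sqrt_mult mult.assoc)
  have le2: "sqrt (real k * real m * real r) \<le> sqrt (real k) * real m"
    unfolding km2[symmetric] using \<open>r \<le> m\<close> by (intro real_sqrt_le_mono mult_left_mono) auto
  have eq1: "pairwise disjnt E" if "x = sqrt (real k * real m * real r)"
  proof -
    have "x\<^sup>2 = real k * real m * real r" unfolding that by simp
    then have cs: "(\<Sum>i\<in>I. sqrt (d i))\<^sup>2 = card I * (\<Sum>i\<in>I. (sqrt (d i))\<^sup>2)"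
      unfolding x sq r by (simp add: mult_ac)
    \<comment> \<open>In the equality case every \<open>sqrt (d i)\<close> with \<open>i\<close> in
      \<open>I\<close> is the mean \<open>x / real r\<close>.\<close>
    define c where "c = (x / real r)\<^sup>2"
    have "d i = c" if "i \<in> I" for i
      using sum_power2_le_card(2)[OF I(1) cs that] d_sqrt[OF that] by (simp add: c_def x r)
    then have "\<forall>i<n. D $$ (i, i) = 0 \<or> D $$ (i, i) = c" by (auto simp: I_def d_def)
    then have "A * A = c \<cdot>\<^sub>m A" using similar_diagonal_quadratic[OF A wit diag] by blast
    then show ?thesis
      using incidence_gram_quadratic_imp_disjoint[OF vs(1), of es k c] e es(2) by (simp add: A_def assms(5))
  qed
  have disj: "x = sqrt (real k) * real m \<and> r = m" if "pairwise disjnt E"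
  proof -
    have "A * A = real k \<cdot>\<^sub>m A"
      using incidence_gram_disjoint[OF vs(1) es(1), of k] e that es(2) by (simp add: A_def assms(5))
    then have dk: "d i = real k" if "i \<in> I" for i
      using similar_diagonal_quadratic[OF A wit diag] that by (auto simp: I_def d_def)
    \<comment> \<open>The trace is now a sum of \<open>r\<close> copies of \<open>k\<close>.\<close>
    then have "real k * real m = real k * real r" using km by (auto simp: r)
    then have "r = m" using k by simp
    then show ?thesis using dk by (simp add: x r)
  qed
  \<comment> \<open>If \<open>x\<close> attains the larger bound, \<open>le1\<close> and
    \<open>le2\<close> force it to attain the smaller one too, so \<open>eq1\<close> applies.
    Conversely, disjointness gives \<open>r = m\<close>, and by \<open>km2\<close> the two bounds
    coincide.\<close>
  show ?thesis using le1 le2 eq1 disj km2 unfolding x_def by fastforce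
qed

end
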